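(* Let $\ell>1$ be an integer. For integers $n\ge\ell$ and $k\ge1$, let $f^{(\ell)}_{n,k}$ be the number of fixed points of $\big((1\,2\,\cdots\,\ell)\big)^{\odot k}$, where $(1\,2\,\cdots\,\ell)\in\mathfrak{S}_n$ is the $\ell$-cycle fixing $\ell+1,\dots,n$. Then for all $k\ge1$, $n\ge\ell$: $$f^{(\ell)}_{n,k}=\begin{cases} n-\ell & \text{if } k=1,\\ 1 & \text{if } n=\ell \text{ and } k\equiv 0 \pmod{\ell},\\ 0 & \text{if } n=\ell \text{ and } k\not\equiv 0\pmod{\ell},\\ f^{(\ell)}_{n-1,k}+f^{(\ell)}_{n,k-1} & \text{otherwise (i.e. } k>1,\ n>\ell).\end{cases}$$
   Context: For positive integers $n,k$, let $\mathcal{C}_{n,k}$ be the set of weakly increasing $k$-tuples $(i_1\le\cdots\le i_k)$ with entries in $[n]$ (equivalently, $k$-element multisets from $[n]$). For $\sigma\in\mathfrak{S}_n$, the $k$-th symmetric tensor power $\sigma^{\odot k}$ is the permutation of $\mathcal{C}_{n,k}$ sending $(i_1,\dots,i_k)$ to the weakly increasing rearrangement of $(\sigma(i_1),\dots,\sigma(i_k))$ (equivalently, the permutation given by the $k$-th symmetric tensor power of the permutation matrix of $\sigma$). *)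

theory Defs
  imports "HOL-Combinatorics.Combinatorics" "HOL-Number_Theory.Cong"
begin

definition incr_tuples :: "nat \<Rightarrow> nat \<Rightarrow> nat list set" where
  "incr_tuples n k = {xs. length xs = k \<and> set xs \<subseteq> {1..n} \<and> sorted xs}"

text \<open>
  Following the convention of \<^const>\<open>permutes\<close>, the permutation of
  \<^term>\<open>incr_tuples n k\<close> is extended by the identity to all lists.
\<close>

definition sym_tensor_power :: "nat \<Rightarrow> nat \<Rightarrow> (nat \<Rightarrow> nat) \<Rightarrow> nat list \<Rightarrow> nat list" where
  "sym_tensor_power n k \<sigma> xs = (if xs \<in> incr_tuples n k then sort (map \<sigma> xs) else xs)"

lemma finite_incr_tuples: "finite (incr_tuples n k)"
proof -
  have "finite {xs. set xs \<subseteq> {1..n} \<and> length xs = k}"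
    by (rule finite_lists_length_eq) simp
  then show ?thesis
    by (rule rev_finite_subset) (auto simp: incr_tuples_def)
qed

lemma sym_tensor_power_permutes:
  assumes "\<sigma> permutes {1..n}"
  shows "sym_tensor_power n k \<sigma> permutes incr_tuples n k"
proof (rule bij_imp_permutes)
  have inj: "inj_on (sym_tensor_power n k \<sigma>) (incr_tuples n k)"
  proof (rule inj_onI)
    fix xs ys
    assume xs: "xs \<in> incr_tuples n k" and ys: "ys \<in> incr_tuples n k"
      and "sym_tensor_power n k \<sigma> xs = sym_tensor_power n k \<sigma> ys"
    then have "mset (sort (map \<sigma> xs)) = mset (sort (map \<sigma> ys))"
      by (simp add: sym_tensor_power_def)
    then have "image_mset \<sigma> (mset xs) = image_mset \<sigma> (mset ys)"
      by simp
    then have "image_mset (inv \<sigma>) (image_mset \<sigma> (mset xs)) = image_mset (inv \<sigma>) (image_mset \<sigma> (mset ys))"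
      by simp
    then have "mset xs = mset ys"
      using permutes_inverses(2)[OF assms] by (simp add: multiset.map_comp comp_def)
    then show "xs = ys"
      using xs ys by (metis (mono_tags) incr_tuples_def mem_Collect_eq properties_for_sort)
  qed
  have sub: "sym_tensor_power n k \<sigma> ` incr_tuples n k \<subseteq> incr_tuples n k"
    using permutes_image[OF assms]
    by (force simp: sym_tensor_power_def incr_tuples_def simp del: atLeastAtMost_iff)
  show "bij_betw (sym_tensor_power n k \<sigma>) (incr_tuples n k) (incr_tuples n k)"
    unfolding bij_betw_def using inj endo_inj_surj[OF finite_incr_tuples sub inj] by simp
qed (simp add: sym_tensor_power_def)

text \<open>The cycle \<open>(1 2 \<dots> l)\<close>, fixing every number outside \<open>{1..l}\<close>.\<close>

definition initial_cycle :: "nat \<Rightarrow> nat \<Rightarrow> nat" where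
  "initial_cycle l = cycle_of_list [1..<Suc l]"

lemma initial_cycle_permutes:
  assumes "l \<le> n"
  shows "initial_cycle l permutes {1..n}"
proof -
  have "initial_cycle l permutes set [1..<Suc l]"
    unfolding initial_cycle_def by (rule cycle_permutes)
  then show ?thesis
    by (rule permutes_subset) (use assms in auto)
qed

lemma initial_cycle_apply:
  "initial_cycle l i = (if 1 \<le> i \<and> i < l then Suc i else if 1 \<le> i \<and> i = l then 1 else i)"
proof -
  have gen: "cycle_of_list [a..<Suc (a + d)] i =
    (if a \<le> i \<and> i < a + d then Suc i else if i = a + d then a else i)" for a d i :: nat
  proof (induction d arbitrary: a)
    case 0
    then show ?case by simp
  next
    case (Suc d)
    have whole: "[a..<Suc (a + Suc d)] = a # Suc a # [Suc (Suc a)..<Suc (Suc a + d)]"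
      by (simp add: upt_conv_Cons)
    have tail: "[Suc a..<Suc (Suc a + d)] = Suc a # [Suc (Suc a)..<Suc (Suc a + d)]"
      by (simp add: upt_conv_Cons)
    have "cycle_of_list [a..<Suc (a + Suc d)] i =
        transpose a (Suc a) (cycle_of_list [Suc a..<Suc (Suc a + d)] i)"
      unfolding whole tail by (simp only: cycle_of_list.simps comp_apply)
    then show ?case
      unfolding Suc.IH[of "Suc a"] by (auto simp: transpose_def)
  qed
  show ?thesis
  proof (cases l)
    case 0
    then show ?thesis by (simp add: initial_cycle_def)
  next
    case (Suc d)
    then show ?thesis using gen[of 1 d i] by (auto simp: initial_cycle_def)
  qed
qed

definition cycle_fixed_count :: "nat \<Rightarrow> nat \<Rightarrow> nat \<Rightarrow> nat" where
  "cycle_fixed_count l n k =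
    card {xs \<in> incr_tuples n k. sym_tensor_power n k (initial_cycle l) xs = xs}"

end

theory Submission
  imports Defs
begin

text \<open>
  Reading tuples as multisets, the fixed points become the multisets that are invariant under the
  cycle. If \<open>l < n\<close> then \<open>n\<close> is fixed by the cycle, and splitting the invariant multisets according
  to whether they contain \<open>n\<close> (and removing one copy if so) gives the Pascal recursion. If
  \<open>n = l\<close>, transitivity of the cycle forces all multiplicities to be equal, so the only invariant
  multisets are the multiples of \<open>{1..l}\<close>.
\<close>

text \<open>Arbitrary \<open>f\<close> and \<open>A\<close> allow the recursion to compare
  \<open>A\<close> with \<open>insert a A\<close> under one and the same map.\<close>

definition invariant_msets :: "('a \<Rightarrow> 'a) \<Rightarrow> 'a set \<Rightarrow> nat \<Rightarrow> 'a multiset set" where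
  "invariant_msets f A k = {M. size M = k \<and> set_mset M \<subseteq> A \<and> image_mset f M = M}"

lemma finite_invariant_msets:
  assumes "finite A"
  shows "finite (invariant_msets f A k)"
proof (rule finite_subset)
  show "invariant_msets f A k \<subseteq> mset ` {xs. set xs \<subseteq> A \<and> length xs = k}"
  proof
    fix M assume M: "M \<in> invariant_msets f A k"
    obtain xs where "mset xs = M" using ex_mset by blast
    with M show "M \<in> mset ` {xs. set xs \<subseteq> A \<and> length xs = k}"
      by (auto simp: invariant_msets_def)
  qed
qed (simp add: finite_lists_length_eq assms)

lemma card_invariant_msets_1:
  "card (invariant_msets f A 1) = card {x \<in> A. f x = x}"
proof -
  have "invariant_msets f A 1 = (\<lambda>x. {#x#}) ` {x \<in> A. f x = x}"
    by (auto simp: invariant_msets_def image_iff dest!: size_1_singleton_mset[simplified])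
  then show ?thesis by (simp add: card_image inj_on_def)
qed

text \<open>As \<open>f a = a\<close>, adding or removing one copy of \<open>a\<close> preserves
  invariance. Further copies of \<open>a\<close> may remain after a removal, so the second summand
  still ranges over \<open>insert a A\<close>.\<close>

lemma card_invariant_msets_insert:
  assumes "finite A" "a \<notin> A" "f a = a"
  shows "card (invariant_msets f (insert a A) (Suc k)) =
    card (invariant_msets f A (Suc k)) + card (invariant_msets f (insert a A) k)"
proof -
  let ?with = "add_mset a ` invariant_msets f (insert a A) k"
  have "invariant_msets f (insert a A) (Suc k) = invariant_msets f A (Suc k) \<union> ?with" (is "?L = ?R")
  proof
    show "?L \<subseteq> ?R"
    proof
      fix M assume M: "M \<in> ?L"
      show "M \<in> ?R"
      proof (cases "a \<in># M")
        case True
        then obtain N where "M = add_mset a N" by (metis mset_add)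
        with M assms(3) show ?thesis by (auto simp: invariant_msets_def)
      next
        case False
        with M show ?thesis by (auto simp: invariant_msets_def)
      qed
    qed
    show "?R \<subseteq> ?L" using assms(3) by (auto simp: invariant_msets_def)
  qed
  moreover have "invariant_msets f A (Suc k) \<inter> ?with = {}"
    using assms(2) by (auto simp: invariant_msets_def)
  moreover have "card ?with = card (invariant_msets f (insert a A) k)"
    by (rule card_image) (simp add: inj_on_def)
  ultimately show ?thesis
    using assms(1) by (simp add: card_Un_disjoint finite_invariant_msets)
qed

text \<open>A sorted list is the unique sorted arrangement of its multiset, and sorting forgets
  exactly the order. Hence being fixed by the tensor power means that \<open>image_mset\<close> of
  the cycle fixes the multiset.\<close>

lemma cycle_fixed_count_eq_card_invariant_msets:
  assumes "l \<le> n"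
  shows "cycle_fixed_count l n k = card (invariant_msets (initial_cycle l) {1..n} k)"
proof -
  have "bij_betw mset {xs \<in> incr_tuples n k. sym_tensor_power n k (initial_cycle l) xs = xs}
    (invariant_msets (initial_cycle l) {1..n} k)"
  proof (rule bij_betw_byWitness[where f' = sorted_list_of_multiset])
    show "mset ` {xs \<in> incr_tuples n k. sym_tensor_power n k (initial_cycle l) xs = xs}
        \<subseteq> invariant_msets (initial_cycle l) {1..n} k"
    proof clarify
      fix xs assume xs: "xs \<in> incr_tuples n k" "sym_tensor_power n k (initial_cycle l) xs = xs"
      then have "sort (map (initial_cycle l) xs) = xs" by (simp add: sym_tensor_power_def)
      then have "image_mset (initial_cycle l) (mset xs) = mset xs" by (metis mset_map mset_sort)
      with xs(1) show "mset xs \<in> invariant_msets (initial_cycle l) {1..n} k"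
        by (simp add: invariant_msets_def incr_tuples_def)
    qed
    show "sorted_list_of_multiset ` invariant_msets (initial_cycle l) {1..n} k
        \<subseteq> {xs \<in> incr_tuples n k. sym_tensor_power n k (initial_cycle l) xs = xs}"
    proof clarify
      fix M assume M: "M \<in> invariant_msets (initial_cycle l) {1..n} k"
      let ?xs = "sorted_list_of_multiset M"
      have "length ?xs = k"
        using M by (simp add: invariant_msets_def flip: size_mset)
      then have xs: "?xs \<in> incr_tuples n k"
        using M by (simp add: invariant_msets_def incr_tuples_def sorted_sorted_list_of_multiset)
      have "sort (map (initial_cycle l) ?xs) = ?xs"
        using M by (intro properties_for_sort)
          (simp_all add: invariant_msets_def sorted_sorted_list_of_multiset)
      with xs show "?xs \<in> incr_tuples n k \<and> sym_tensor_power n k (initial_cycle l) ?xs = ?xs"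
        by (simp add: sym_tensor_power_def)
    qed
  \<comment> \<open>What remains is that the two maps are mutually inverse; one direction uses that
    the tuples are sorted.\<close>
  qed (auto simp: incr_tuples_def sorted_sort_id)
  then show ?thesis unfolding cycle_fixed_count_def by (rule bij_betw_same_card)
qed

lemma inj_initial_cycle: "inj (initial_cycle l)"
  using initial_cycle_permutes[OF order_refl] by (rule permutes_inj)

text \<open>By injectivity only copies of \<open>x\<close> are sent to \<open>f x\<close>. For an
  invariant \<open>M\<close> this makes multiplicities constant along orbits of
  \<open>f\<close>.\<close>

lemma count_image_mset_inj:
  assumes "inj f"
  shows "count (image_mset f M) (f x) = count M x"
  by (induction M) (simp_all add: inj_eq[OF assms])

lemma invariant_mset_initial_cycle_uniform:
  assumes "image_mset (initial_cycle l) M = M" "set_mset M \<subseteq> {1..l}"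
  shows "M = repeat_mset (count M 1) (mset_set {1..l})"
proof (rule multiset_eqI)
  have step: "count M (initial_cycle l i) = count M i" for i
    using count_image_mset_inj[OF inj_initial_cycle[of l], of M i] assms(1) by simp
  \<comment> \<open>Walk along the cycle from 1 upwards; the bound \<open>Suc j \<le> l\<close>
    stops the walk before it wraps around to 1.\<close>
  have const: "Suc j \<le> l \<Longrightarrow> count M (Suc j) = count M 1" for j
  proof (induction j)
    case (Suc j)
    then show ?case using step[of "Suc j"] by (simp add: initial_cycle_apply)
  qed simp
  fix i
  show "count M i = count (repeat_mset (count M 1) (mset_set {1..l})) i"
  proof (cases "i \<in> {1..l}")
    case True
    then show ?thesis using const[of "i - 1"] by simp
  next
    case False
    with assms(2) have "i \<notin># M" by blast
    with False show ?thesis by (simp add: not_in_iff)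
  qed
qed

lemma repeat_mset_initial_cycle_invariant:
  "image_mset (initial_cycle l) (repeat_mset c (mset_set {1..l})) = repeat_mset c (mset_set {1..l})"
proof -
  have "image_mset (initial_cycle l) (mset_set {1..l}) = mset_set {1..l}"
    using permutes_image[OF initial_cycle_permutes[OF order_refl]]
    by (simp add: image_mset_mset_set inj_on_subset[OF inj_initial_cycle])
  then show ?thesis by (induction c) simp_all
qed

text \<open>An invariant multiset made of \<open>c\<close> copies of \<open>{1..l}\<close> has size
  \<open>c * l\<close>, so \<open>k\<close> determines \<open>c\<close> as \<open>k div l\<close>,
  and none exists unless \<open>l dvd k\<close>.\<close>

lemma card_invariant_msets_initial_cycle:
  assumes "l > 0"
  shows "card (invariant_msets (initial_cycle l) {1..l} k) = (if l dvd k then 1 else 0)"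
proof -
  let ?U = "mset_set {1..l}"
  have size: "size (repeat_mset c ?U) = c * l" for c by simp
  have "M = repeat_mset (k div l) ?U \<and> l dvd k"
    if M_in: "M \<in> invariant_msets (initial_cycle l) {1..l} k" for M
  proof -
    have inv: "image_mset (initial_cycle l) M = M" "set_mset M \<subseteq> {1..l}"
      using M_in by (simp_all add: invariant_msets_def)
    obtain c where M: "M = repeat_mset c ?U"
      using invariant_mset_initial_cycle_uniform[OF inv] by (rule that)
    have "k = size M" using M_in by (simp add: invariant_msets_def)
    also have "\<dots> = c * l" unfolding M by (rule size)
    finally show ?thesis using M assms by simp
  qed
  moreover have "repeat_mset (k div l) ?U \<in> invariant_msets (initial_cycle l) {1..l} k" if "l dvd k"
  proof -
    have "set_mset (repeat_mset c ?U) \<subseteq> {1..l}" for c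
      by (induction c) auto
    then show ?thesis
      using that repeat_mset_initial_cycle_invariant[of l "k div l"] size[of "k div l"]
      unfolding invariant_msets_def by simp
  qed
  \<comment> \<open>Written this way, the set is visibly a singleton or empty according to
    \<open>l dvd k\<close>.\<close>
  ultimately have "invariant_msets (initial_cycle l) {1..l} k =
      {M. M = repeat_mset (k div l) ?U \<and> l dvd k}"
    by blast
  then show ?thesis by simp
qed

theorem theorem3p4:
  fixes l n k :: nat
  assumes "l > 1" and "n \<ge> l" and "k \<ge> 1"
  shows "cycle_fixed_count l n k =
    (if k = 1 then n - l
     else if n = l \<and> [k = 0] (mod l) then 1
     else if n = l \<and> [k \<noteq> 0] (mod l) then 0
     else cycle_fixed_count l (n - 1) k + cycle_fixed_count l n (k - 1))"
proof -
  consider "k = 1" | "k \<noteq> 1" "n = l" | "k \<noteq> 1" "n > l" using assms(2) by linarith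
  then show ?thesis
  proof cases
    case 1
    \<comment> \<open>As \<open>l > 1\<close>, the cycle moves every point of \<open>{1..l}\<close>;
      for \<open>l = 1\<close> the point 1 would be fixed.\<close>
    have "{x \<in> {1..n}. initial_cycle l x = x} = {Suc l..n}"
      using assms(1) by (auto simp: initial_cycle_apply split: if_splits)
    then show ?thesis
      using 1 assms(2)
      by (simp add: cycle_fixed_count_eq_card_invariant_msets card_invariant_msets_1[simplified])
  next
    case 2
    then show ?thesis
      using assms(1) card_invariant_msets_initial_cycle[of l k]
      by (simp add: cycle_fixed_count_eq_card_invariant_msets cong_0_iff)
  next
    case 3
    \<comment> \<open>The bound \<open>l \<le> m\<close> lets the multiset description apply to
      \<open>n - 1\<close> as well, with the same map, since \<open>initial_cycle l\<close> does not
      depend on \<open>n\<close>.\<close>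
    then obtain m where m: "n = Suc m" "l \<le> m" by (cases n) auto
    obtain j where j: "k = Suc j" using assms(3) by (cases k) auto
    have "initial_cycle l n = n" using 3 by (simp add: initial_cycle_apply)
    then show ?thesis
      using 3 m j card_invariant_msets_insert[of "{1..m}" n "initial_cycle l" j]
      by (simp add: cycle_fixed_count_eq_card_invariant_msets atLeastAtMostSuc_conv)
  qed
qed

end
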